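(* Let $p\ge5$ be a prime and let $n:=2^{p-1}$. The number $2^p-1$ is prime if and only if $$\Omega_0(\lfloor n/2\rfloor\,|\,0,-1\,|\,n)\;\Omega_0(\lfloor p/2\rfloor\,|\,{-2},-5\,|\,p)\;\Big|\;\Omega_0(\lfloor n/2\rfloor\,|\,1,4\,|\,n)\;\Omega_0(\lfloor p/2\rfloor\,|\,0,-1\,|\,p).$$
   Context: For a natural number $m$, $\delta(m)\in\{0,1\}$ denotes $m\bmod 2$. Divisibility is in the integers. For a natural number $N$, the Quanta Prime Sequence $\Omega_r(k|\zeta,\xi|N)$ associated with $N$ and a point $(\zeta,\xi)\ne(0,0)$ is defined for integers $r,k\ge0$ with $r+k\le\lfloor N/2\rfloor$ by $\Omega_r(0|\zeta,\xi|N)=1$ for all $r$, and for $k\ge1$ $$\Omega_r(k|\zeta,\xi|N)=(2\zeta-\xi)(N-r-k)\,\Omega_r(k-1|\zeta,\xi|N)-2\zeta\,(N-2r-\delta(N-1))\,\Omega_{r+1}(k-1|\zeta,\xi|N).$$ *)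

theory Defs
  imports Complex_Main "HOL-Computational_Algebra.Primes"
begin

definition parity_bit :: "nat \<Rightarrow> nat" where
  "parity_bit m = m mod 2"

text \<open>
  \<open>quanta_Omega r k \<zeta> \<xi> N\<close> is $\Omega_r(k|\zeta,\xi|N)$. The sequence is meant for
  \<open>r + k \<le> N div 2\<close> and \<open>(\<zeta>, \<xi>) \<noteq> (0, 0)\<close>. The function is total, but the recursion
  never leaves this range, since \<open>r + k\<close> does not grow along it; values outside the range
  (including those for \<open>N = 0\<close>, where \<open>N - 1\<close> truncates) carry no meaning.
  The factors \<open>N - r - k\<close> and \<open>N - 2 r - parity_bit (N - 1)\<close> are computed in the ring.
\<close>

primrec quanta_Omega :: "nat \<Rightarrow> nat \<Rightarrow> 'a \<Rightarrow> 'a \<Rightarrow> nat \<Rightarrow> 'a::comm_ring_1" where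
  "quanta_Omega r 0 \<zeta> \<xi> N = 1"
| "quanta_Omega r (Suc k) \<zeta> \<xi> N =
     (2 * \<zeta> - \<xi>) * (of_nat N - of_nat r - of_nat (Suc k)) * quanta_Omega r k \<zeta> \<xi> N
     - 2 * \<zeta> * (of_nat N - 2 * of_nat r - of_nat (parity_bit (N - 1)))
         * quanta_Omega (Suc r) k \<zeta> \<xi> N"

end

theory Submission
  imports Defs "HOL-Number_Theory.Number_Theory"
begin

text \<open>If \<open>x + y = 1\<close> and \<open>(2 \<zeta> - \<xi>) x y = \<zeta>\<close>, then \<open>\<Omega>\<^sub>0(h|\<zeta>,\<xi>|N)\<close> with \<open>h = \<lfloor>N/2\<rfloor>\<close> is
  \<open>(2 \<zeta> - \<xi>)\<^sup>h (x\<^sup>N + y\<^sup>N)\<close> times a nonzero factor that depends only on \<open>N\<close>: expanding the recursion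
  gives the Girard--Waring expansion of \<open>x\<^sup>N + y\<^sup>N\<close> in \<open>x y\<close>. The point \<open>(0, -1)\<close> has \<open>{x, y} = {1, 0}\<close>
  and isolates this factor, \<open>(-2, -5)\<close> has \<open>{x, y} = {2, -1}\<close> and contributes \<open>2\<^sup>p - 1\<close>, and \<open>(1, 4)\<close>
  has \<open>{x, y} = {(1 + sqrt 3)/2, (1 - sqrt 3)/2}\<close> and contributes
  \<open>(2 + sqrt 3)\<^sup>h + (2 - sqrt 3)\<^sup>h\<close> with \<open>h = n/2 = 2\<^sup>p\<^sup>-\<^sup>2\<close>. The divisibility is therefore the
  Lucas--Lehmer test, which is proved by computing with powers of \<open>2 + sqrt 3\<close> modulo \<open>2\<^sup>p - 1\<close>.\<close>

section \<open>Closed form of the Quanta Prime Sequence\<close>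

text \<open>Pascal's rule, arranged to mirror the recursion: the extra step is counted either by
  \<open>F\<close> or by \<open>G\<close>.\<close>

lemma sum_choose_Suc:
  fixes F G :: "nat \<Rightarrow> 'a::comm_ring_1"
  shows "(\<Sum>j\<le>Suc k. of_nat (Suc k choose j) * F (Suc k - j) * G j) =
    (\<Sum>j\<le>k. of_nat (k choose j) * F (Suc k - j) * G j) +
    (\<Sum>j\<le>k. of_nat (k choose j) * F (k - j) * G (Suc j))"
proof -
  have 0: "k choose Suc k = 0"
    by (rule binomial_eq_0) simp
  have *: "(\<Sum>j\<le>k. of_nat (k choose j) * F (Suc k - j) * G j) =
      F (Suc k) * G 0 + (\<Sum>j\<le>k. of_nat (k choose Suc j) * F (k - j) * G (Suc j))"
    using sum.atMost_Suc_shift[of "\<lambda>j. of_nat (k choose j) * F (Suc k - j) * G j" k]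
    unfolding sum.atMost_Suc 0 by simp
  show ?thesis
    unfolding * by (subst sum.atMost_Suc_shift) (simp add: distrib_right sum.distrib)
qed

text \<open>A step with factor \<open>N - r - k\<close> lowers \<open>r + k\<close> and keeps \<open>r\<close>, the other kind of step keeps
  \<open>r + k\<close> and raises \<open>r\<close>. Hence the weight of a path depends only on how many steps of each kind
  it has.\<close>

lemma quanta_Omega_sum:
  "quanta_Omega r k \<zeta> \<xi> N = (\<Sum>j\<le>k. of_nat (k choose j) *
     ((2 * \<zeta> - \<xi>) ^ (k - j) * (\<Prod>i<k - j. of_nat N - of_nat (r + k) + of_nat i)) *
     ((- 2 * \<zeta>) ^ j * (\<Prod>i<j. of_nat N - 2 * of_nat (r + i) - of_nat (parity_bit (N - 1)))))"
proof (induction k arbitrary: r)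
  case 0
  then show ?case by simp
next
  case (Suc k)
  define F where "F m = (2 * \<zeta> - \<xi>) ^ m * (\<Prod>i<m. of_nat N - of_nat (r + Suc k) + of_nat i)" for m
  define G where "G j = (- 2 * \<zeta>) ^ j *
    (\<Prod>i<j. of_nat N - 2 * of_nat (r + i) - of_nat (parity_bit (N - 1)))" for j
  \<comment> \<open>The factor \<open>i = 0\<close> is split off: it is the coefficient in the
    recursion, and the remaining factors belong to \<open>r + k\<close> instead of
    \<open>r + Suc k\<close>.\<close>
  have F: "F (Suc m) = (2 * \<zeta> - \<xi>) * (of_nat N - of_nat r - of_nat (Suc k)) *
      ((2 * \<zeta> - \<xi>) ^ m * (\<Prod>i<m. of_nat N - of_nat (r + k) + of_nat i))" for m
    unfolding F_def prod.lessThan_Suc_shift by (simp add: algebra_simps)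
  have G: "G (Suc j) = - 2 * \<zeta> * (of_nat N - 2 * of_nat r - of_nat (parity_bit (N - 1))) *
      ((- 2 * \<zeta>) ^ j *
        (\<Prod>i<j. of_nat N - 2 * of_nat (Suc r + i) - of_nat (parity_bit (N - 1))))" for j
    unfolding G_def prod.lessThan_Suc_shift by (simp add: algebra_simps)
  have 1: "(2 * \<zeta> - \<xi>) * (of_nat N - of_nat r - of_nat (Suc k)) * quanta_Omega r k \<zeta> \<xi> N =
      (\<Sum>j\<le>k. of_nat (k choose j) * F (Suc k - j) * G j)"
    unfolding Suc.IH[of r] sum_distrib_left
    by (rule sum.cong) (simp_all add: Suc_diff_le F G_def mult_ac)
  have 2: "- 2 * \<zeta> * (of_nat N - 2 * of_nat r - of_nat (parity_bit (N - 1))) *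
      quanta_Omega (Suc r) k \<zeta> \<xi> N = (\<Sum>j\<le>k. of_nat (k choose j) * F (k - j) * G (Suc j))"
    unfolding Suc.IH[of "Suc r"] sum_distrib_left G F_def
    by (rule sum.cong) (simp_all add: mult_ac)
  have "quanta_Omega r (Suc k) \<zeta> \<xi> N =
      (2 * \<zeta> - \<xi>) * (of_nat N - of_nat r - of_nat (Suc k)) * quanta_Omega r k \<zeta> \<xi> N +
      - 2 * \<zeta> * (of_nat N - 2 * of_nat r - of_nat (parity_bit (N - 1))) *
      quanta_Omega (Suc r) k \<zeta> \<xi> N"
    by simp
  also have "\<dots> = (\<Sum>j\<le>Suc k. of_nat (Suc k choose j) * F (Suc k - j) * G j)"
    unfolding 1 2 sum_choose_Suc ..
  finally show ?case
    unfolding F_def G_def .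
qed

text \<open>Integer values can thus be computed in the reals, where \<open>x\<close> and
  \<open>y\<close> may be irrational and factorials cancel.\<close>

lemma of_int_quanta_Omega:
  "of_int (quanta_Omega r k \<zeta> \<xi> N) = quanta_Omega r k (of_int \<zeta>) (of_int \<xi>) N"
  by (induction k arbitrary: r) simp_all

section \<open>The Girard--Waring expansion\<close>

text \<open>Pascal's rule along the shallow diagonals of Pascal's triangle; \<open>t = 1\<close> is
  the Fibonacci recurrence. Summands with \<open>2 * j\<close> above the row index vanish, so the
  long summation ranges are harmless.\<close>

lemma sum_choose_diagonal_Suc_Suc:
  fixes t :: "'a::comm_ring_1"
  shows "(\<Sum>j\<le>Suc (Suc n). of_nat (Suc (Suc n) - j choose j) * t ^ j) =
    (\<Sum>j\<le>Suc n. of_nat (Suc n - j choose j) * t ^ j) +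
    t * (\<Sum>j\<le>n. of_nat (n - j choose j) * t ^ j)"
proof -
  have "(\<Sum>j\<le>Suc (Suc n). of_nat (Suc (Suc n) - j choose j) * t ^ j) =
      1 + (\<Sum>j\<le>n. of_nat (Suc n - j choose Suc j) * t ^ Suc j)"
    by (subst sum.atMost_Suc_shift) simp
  also have "(\<Sum>j\<le>n. of_nat (Suc n - j choose Suc j) * t ^ Suc j) =
      (\<Sum>j\<le>n. of_nat (n - j choose Suc j) * t ^ Suc j + t * (of_nat (n - j choose j) * t ^ j))"
    by (rule sum.cong) (simp_all add: Suc_diff_le algebra_simps)
  also have "1 + \<dots> = (1 + (\<Sum>j\<le>n. of_nat (n - j choose Suc j) * t ^ Suc j)) +
      t * (\<Sum>j\<le>n. of_nat (n - j choose j) * t ^ j)"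
    by (simp add: sum.distrib sum_distrib_left)
  also have "1 + (\<Sum>j\<le>n. of_nat (n - j choose Suc j) * t ^ Suc j) =
      (\<Sum>j\<le>Suc n. of_nat (Suc n - j choose j) * t ^ j)"
    by (subst sum.atMost_Suc_shift) simp
  finally show ?thesis .
qed

text \<open>A division-free form of the Girard--Waring coefficient \<open>N / (N - j) * (N - j choose j)\<close>.\<close>

definition lucas_coeff :: "nat \<Rightarrow> nat \<Rightarrow> nat" where
  "lucas_coeff N j = (N - j choose j) + (case j of 0 \<Rightarrow> 0 | Suc i \<Rightarrow> N - Suc j choose i)"

text \<open>Over the common denominator \<open>fact j * fact (N - 2 * j)\<close> the two binomials
  have numerators \<open>fact (N - j)\<close> and \<open>j * fact (N - 1 - j)\<close>, and
  \<open>(N - j) + j = N\<close>.\<close>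

lemma lucas_coeff_fact:
  assumes "2 * j \<le> N" "0 < N"
  shows "lucas_coeff N j * (fact j * fact (N - 2 * j)) = N * fact (N - 1 - j)"
proof (cases j)
  case 0
  with assms show ?thesis
    by (cases N) (simp_all add: lucas_coeff_def)
next
  case (Suc i)
  obtain m where N: "N = 2 * j + m"
    using assms le_Suc_ex by blast
  have 1: "(N - j choose j) * (fact j * fact m) = fact (j + m)"
    using binomial_fact_lemma[of j "j + m"] by (simp add: N mult_ac)
  have 2: "(N - Suc j choose i) * (fact i * fact m) = fact (i + m)"
    using binomial_fact_lemma[of i "i + m"] by (simp add: N Suc mult_ac)
  have "lucas_coeff N j * (fact j * fact m) =
      (N - j choose j) * (fact j * fact m) + j * ((N - Suc j choose i) * (fact i * fact m))"
    by (simp add: lucas_coeff_def Suc algebra_simps)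
  also have "\<dots> = N * fact (i + m)"
    unfolding 1 2 by (simp add: N Suc algebra_simps)
  finally show ?thesis
    by (simp add: N Suc)
qed

text \<open>Both \<open>x\<close> and \<open>y\<close> satisfy \<open>z * z = z + t\<close> with
  \<open>t = - (x * y)\<close>, so their powers obey the recurrence of the diagonal sums
  \<open>U\<close>. The two binomials in \<open>lucas_coeff\<close> contribute \<open>U N\<close>
  and \<open>t * U (N - 2)\<close>.\<close>

lemma sum_lucas_coeff:
  fixes x y :: "'a::comm_ring_1"
  assumes "x + y = 1" "2 \<le> N"
  shows "(\<Sum>j\<le>N div 2. of_nat (lucas_coeff N j) * (- (x * y)) ^ j) = x ^ N + y ^ N"
proof -
  define t where "t = - (x * y)"
  define U where "U n = (\<Sum>j\<le>n. of_nat (n - j choose j) * t ^ j)" for n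
  have U_rec: "U (Suc (Suc n)) = U (Suc n) + t * U n" for n
    unfolding U_def by (rule sum_choose_diagonal_Suc_Suc)
  have y: "y = 1 - x"
    using assms(1) by (simp add: algebra_simps)
  have rec: "z ^ Suc (Suc n) = z ^ Suc n + t * z ^ n" if "z = x \<or> z = y" for z n
  proof -
    have "x * x = x + t" "y * y = y + t"
      by (simp_all add: t_def y algebra_simps)
    with that have "z * z = z + t"
      by auto
    then have "z * z * z ^ n = (z + t) * z ^ n"
      by simp
    then show ?thesis
      by (simp add: algebra_simps)
  qed
  have U_power: "U (Suc (Suc n)) + t * U n = x ^ Suc (Suc n) + y ^ Suc (Suc n)" for n
  proof (induction n rule: induct_nat_012)
    case 0
    then show ?case by (simp add: U_def t_def y algebra_simps numeral_2_eq_2)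
  next
    case 1
    then show ?case by (simp add: U_def t_def y algebra_simps numeral_2_eq_2)
  next
    case (ge2 n)
    have "U (Suc (Suc (Suc (Suc n)))) + t * U (Suc (Suc n)) =
        (U (Suc (Suc (Suc n))) + t * U (Suc n)) + t * (U (Suc (Suc n)) + t * U n)"
      by (simp only: U_rec[of "Suc (Suc n)"] U_rec[of n]) (simp add: algebra_simps)
    also have "\<dots> = x ^ Suc (Suc (Suc (Suc n))) + y ^ Suc (Suc (Suc (Suc n)))"
      unfolding ge2 rec[of x "Suc (Suc n)", OF disjI1[OF refl]]
        rec[of y "Suc (Suc n)", OF disjI2[OF refl]]
      by (simp only: distrib_left add_ac)
    finally show ?case .
  qed
  obtain n where N: "N = Suc (Suc n)"
    using assms(2) by (metis Suc_le_D numeral_2_eq_2 Suc_le_mono)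
  have "(\<Sum>j\<le>N div 2. of_nat (lucas_coeff N j) * t ^ j) =
      (\<Sum>j\<le>N. of_nat (lucas_coeff N j) * t ^ j)"
  proof (rule sum.mono_neutral_left)
    show "\<forall>j\<in>{..N} - {..N div 2}. of_nat (lucas_coeff N j) * t ^ j = 0"
    proof
      fix j assume "j \<in> {..N} - {..N div 2}"
      then have "N < 2 * j" by auto
      \<comment> \<open>At \<open>j = N\<close> the subtraction \<open>N - Suc j\<close> truncates
        to 0; \<open>0 < i\<close> still holds there because \<open>N\<close> is at least 2.\<close>
      then have "N - j < j" "\<And>i. j = Suc i \<Longrightarrow> N - Suc j < i"
        using N by auto
      then show "of_nat (lucas_coeff N j) * t ^ j = 0"
        by (auto simp: lucas_coeff_def binomial_eq_0 split: nat.split)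
    qed
  qed auto
  also have "\<dots> = (\<Sum>j\<le>N. of_nat (N - j choose j) * t ^ j) +
      (\<Sum>j\<le>N. of_nat (case j of 0 \<Rightarrow> 0 | Suc i \<Rightarrow> N - Suc j choose i) * t ^ j)"
    by (simp add: lucas_coeff_def algebra_simps sum.distrib)
  also have "(\<Sum>j\<le>N. of_nat (case j of 0 \<Rightarrow> 0 | Suc i \<Rightarrow> N - Suc j choose i) * t ^ j) = t * U n"
    unfolding N U_def by (subst sum.atMost_Suc_shift) (simp add: sum_distrib_left mult_ac)
  finally show ?thesis
    using U_power[of n] unfolding t_def N U_def by simp
qed

section \<open>Comparison of coefficients\<close>

text \<open>\<open>2 * (h - i)\<close> and the \<open>i\<close>-th factor of the product are
  \<open>N - 2 * i\<close> and \<open>N - 2 * i - 1\<close>, in an order given by the parity of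
  \<open>N\<close>. Over \<open>i < j\<close> they multiply to the falling factorial of
  \<open>N\<close> of length \<open>2 * j\<close>.\<close>

lemma choose_half_mult_prod:
  fixes N :: nat
  defines "h \<equiv> N div 2"
  assumes "j \<le> h" "0 < N"
  shows "of_nat (h choose j) * (\<Prod>i<j. of_nat N - 2 * of_nat i - of_nat (parity_bit (N - 1))) *
      (2 ^ j * fact j * fact (N - 2 * j)) = (fact N :: 'a::field_char_0)"
  using assms(2)
proof (induction j)
  case 0
  then show ?case by simp
next
  case (Suc j)
  define Q where "Q j = (\<Prod>i<j. of_nat N - 2 * of_nat i - of_nat (parity_bit (N - 1)) :: 'a)" for j
  obtain l where l: "h = Suc (j + l)"
    using Suc.prems less_iff_Suc_add[of j h] by auto
  define e where "e = N mod 2"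
  have N: "N = 2 * Suc (j + l) + e"
    using l unfolding h_def e_def by presburger
  have e: "e = 0 \<or> e = 1"
    unfolding e_def by auto
  have par: "parity_bit (N - 1) = 1 - e"
    using e unfolding parity_bit_def N by (auto; presburger)
  have step: "2 * of_nat (h - j) * (of_nat N - 2 * of_nat j - of_nat (parity_bit (N - 1))) =
      (of_nat ((N - 2 * j) * (N - 2 * j - 1)) :: 'a)"
    unfolding par using e by (auto simp: l) (auto simp: N algebra_simps)
  have ch: "of_nat (h choose Suc j) * of_nat (Suc j) = (of_nat (h choose j) * of_nat (h - j) :: 'a)"
  proof -
    have "(h choose Suc j) * Suc j = (h choose j) * (h - j)"
      by (metis binomial_absorb_comp binomial_absorption l mult.commute diff_Suc_1)
    then show ?thesis
      by (metis of_nat_mult)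
  qed
  have f: "fact (N - 2 * j) = (of_nat ((N - 2 * j) * (N - 2 * j - 1)) * fact (N - 2 * Suc j) :: 'a)"
  proof -
    define q where "q = N - 2 * Suc j"
    have "N - 2 * j = Suc (Suc q)"
      by (simp add: N q_def)
    then show ?thesis
      unfolding q_def[symmetric] by (simp add: algebra_simps)
  qed
  have "of_nat (h choose Suc j) * Q (Suc j) * (2 ^ Suc j * fact (Suc j) * fact (N - 2 * Suc j)) =
      (of_nat (h choose Suc j) * of_nat (Suc j)) * Q j *
      (2 * (of_nat N - 2 * of_nat j - of_nat (parity_bit (N - 1)))) *
      (2 ^ j * fact j * fact (N - 2 * Suc j))"
    by (simp add: Q_def mult_ac)
  also have "\<dots> = of_nat (h choose j) * Q j * (2 ^ j * fact j *
      ((2 * of_nat (h - j) * (of_nat N - 2 * of_nat j - of_nat (parity_bit (N - 1)))) *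
        fact (N - 2 * Suc j)))"
    unfolding ch by (simp only: mult_ac)
  also have "\<dots> = of_nat (h choose j) * Q j * (2 ^ j * fact j * fact (N - 2 * j))"
    unfolding step f ..
  also have "\<dots> = fact N"
    using Suc unfolding Q_def by simp
  finally show ?case
    unfolding Q_def .
qed

lemma prod_shift_fact:
  assumes "h < N"
  shows "(\<Prod>i<m. of_nat N - of_nat h + of_nat i) * fact (N - h - 1) =
    (fact (N - h - 1 + m) :: 'a::field_char_0)"
proof (induction m)
  case 0
  then show ?case by simp
next
  case (Suc m)
  have "(of_nat N - of_nat h + of_nat m :: 'a) = of_nat (Suc (N - h - 1 + m))"
    using assms by (simp add: of_nat_diff)
  then have "(\<Prod>i<Suc m. of_nat N - of_nat h + of_nat i) * fact (N - h - 1) =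
      of_nat (Suc (N - h - 1 + m)) *
      ((\<Prod>i<m. of_nat N - of_nat h + of_nat i) * (fact (N - h - 1) :: 'a))"
    by (simp only: prod.lessThan_Suc mult_ac)
  also have "\<dots> = fact (N - h - 1 + Suc m)"
    unfolding Suc by simp
  finally show ?case .
qed

text \<open>In \<open>quanta_Omega_sum\<close> the \<open>j\<close>-th coefficient is
  \<open>lucas_coeff N j\<close> times a factor free of \<open>j\<close>. The second hypothesis
  extracts a power of \<open>2 * \<zeta> - \<xi>\<close> from \<open>\<zeta> ^ j\<close>, which
  completes the exponent \<open>h - j\<close> to \<open>h\<close>.\<close>

lemma quanta_Omega_half:
  fixes x y \<zeta> \<xi> :: "'a::field_char_0"
  assumes "x + y = 1" "(2 * \<zeta> - \<xi>) * (x * y) = \<zeta>" "2 \<le> N"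
  defines "h \<equiv> N div 2"
  shows "quanta_Omega 0 h \<zeta> \<xi> N =
    (\<Prod>i<h. of_nat N - of_nat h + of_nat i) * (2 * \<zeta> - \<xi>) ^ h * (x ^ N + y ^ N)"
proof -
  define a where "a = 2 * \<zeta> - \<xi>"
  define P where "P m = (\<Prod>i<m. of_nat N - of_nat h + of_nat i :: 'a)" for m
  define Q where "Q j = (\<Prod>i<j. of_nat N - 2 * of_nat i - of_nat (parity_bit (N - 1)) :: 'a)" for j
  have hN: "h < N"
    using assms by auto
  have coeff: "of_nat (h choose j) * P (h - j) * Q j * 2 ^ j = P h * of_nat (lucas_coeff N j)"
    if j: "j \<le> h" for j
  proof -
    have 1: "P (h - j) * fact (N - h - 1) = fact (N - 1 - j)"
      using prod_shift_fact[OF hN, of "h - j", where 'a = 'a] j hN by (simp add: P_def)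
    have 2: "P h * fact (N - h - 1) = fact (N - 1)"
      using prod_shift_fact[OF hN, of "h", where 'a = 'a] hN by (simp add: P_def)
    have 3: "of_nat (h choose j) * Q j * (2 ^ j * fact j * fact (N - 2 * j)) = fact N"
      using choose_half_mult_prod[of j N, where 'a = 'a] j hN by (simp add: Q_def h_def)
    have "of_nat (lucas_coeff N j * (fact j * fact (N - 2 * j))) =
        (of_nat (N * fact (N - 1 - j)) :: 'a)"
      by (subst lucas_coeff_fact) (use j hN in \<open>auto simp: h_def\<close>)
    then have 4: "of_nat (lucas_coeff N j) * (fact j * fact (N - 2 * j)) =
        (of_nat N * fact (N - 1 - j) :: 'a)"
      by simp
    have 5: "(fact N :: 'a) = of_nat N * fact (N - 1)"
      using hN by (simp add: fact_reduce)
    \<comment> \<open>A product of factorials is nonzero in characteristic 0, so the identity may be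
      checked after multiplication by \<open>D\<close>.\<close>
    define D :: 'a where "D = fact (N - h - 1) * (fact j * fact (N - 2 * j))"
    have "(of_nat (h choose j) * P (h - j) * Q j * 2 ^ j) * D =
        (P (h - j) * fact (N - h - 1)) *
        (of_nat (h choose j) * Q j * (2 ^ j * fact j * fact (N - 2 * j)))"
      by (simp only: D_def mult_ac)
    also have "\<dots> = (P h * fact (N - h - 1)) *
        (of_nat (lucas_coeff N j) * (fact j * fact (N - 2 * j)))"
      unfolding 1 2 3 4 5 by (simp only: mult_ac)
    also have "\<dots> = (P h * of_nat (lucas_coeff N j)) * D"
      by (simp only: D_def mult_ac)
    finally show ?thesis
      by (simp add: D_def)
  qed
  have "quanta_Omega 0 h \<zeta> \<xi> N = (\<Sum>j\<le>h. of_nat (h choose j) *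
      (a ^ (h - j) * P (h - j)) * ((- 2 * \<zeta>) ^ j * Q j))"
    unfolding quanta_Omega_sum a_def P_def Q_def by simp
  also have "\<dots> = (\<Sum>j\<le>h. P h * a ^ h * (of_nat (lucas_coeff N j) * (- (x * y)) ^ j))"
  proof (rule sum.cong)
    fix j assume "j \<in> {..h}"
    then have j: "j \<le> h" by simp
    have "(- 2 * \<zeta>) ^ j = 2 ^ j * (a ^ j * (- (x * y)) ^ j)"
      unfolding power_mult_distrib[symmetric] using assms(2) by (simp add: a_def)
    moreover have "a ^ (h - j) * a ^ j = a ^ h"
      using j by (simp flip: power_add)
    moreover have "of_nat (h choose j) * (a ^ (h - j) * P (h - j)) *
        (2 ^ j * (a ^ j * (- (x * y)) ^ j) * Q j) =
        (of_nat (h choose j) * P (h - j) * Q j * 2 ^ j) * (a ^ (h - j) * a ^ j) * (- (x * y)) ^ j"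
      by (simp only: mult_ac)
    ultimately have "of_nat (h choose j) * (a ^ (h - j) * P (h - j)) * ((- 2 * \<zeta>) ^ j * Q j) =
        (of_nat (h choose j) * P (h - j) * Q j * 2 ^ j) * a ^ h * (- (x * y)) ^ j"
      by simp
    then show "of_nat (h choose j) * (a ^ (h - j) * P (h - j)) * ((- 2 * \<zeta>) ^ j * Q j) =
        P h * a ^ h * (of_nat (lucas_coeff N j) * (- (x * y)) ^ j)"
      unfolding coeff[OF j] by (simp only: mult_ac)
  qed simp
  also have "\<dots> = P h * a ^ h * (x ^ N + y ^ N)"
    unfolding sum_distrib_left[symmetric] h_def by (subst sum_lucas_coeff) (use assms in auto)
  finally show ?thesis
    unfolding P_def a_def .
qed

section \<open>Congruences in the ring of integers adjoined the square root of 3\<close>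

text \<open>The ring is taken inside the reals so that the closed form applies to its elements
  directly. Uniqueness of coordinates then rests on the irrationality of
  \<open>sqrt 3\<close>.\<close>

definition Zsqrt3 :: "real set" where
  "Zsqrt3 = {x. \<exists>a b :: int. x = of_int a + of_int b * sqrt 3}"

lemma Zsqrt3I: "of_int a + of_int b * sqrt 3 \<in> Zsqrt3"
  by (auto simp: Zsqrt3_def)

lemma Zsqrt3_of_int [simp]: "of_int a \<in> Zsqrt3"
  using Zsqrt3I[of a 0] by simp

lemma Zsqrt3_numeral [simp]: "numeral k \<in> Zsqrt3" "1 \<in> Zsqrt3" "0 \<in> Zsqrt3"
  using Zsqrt3_of_int[of "numeral k"] Zsqrt3_of_int[of 1] Zsqrt3_of_int[of 0] by simp_all

lemma Zsqrt3_of_nat [simp]: "of_nat n \<in> Zsqrt3"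
  using Zsqrt3_of_int[of "int n"] by simp

lemma Zsqrt3_sqrt3 [simp]: "sqrt 3 \<in> Zsqrt3"
  using Zsqrt3I[of 0 1] by simp

lemma Zsqrt3_add [simp]:
  assumes "x \<in> Zsqrt3" "y \<in> Zsqrt3"
  shows "x + y \<in> Zsqrt3"
proof -
  obtain a b c d where "x = of_int a + of_int b * sqrt 3" "y = of_int c + of_int d * sqrt 3"
    using assms by (auto simp: Zsqrt3_def)
  then show ?thesis
    using Zsqrt3I[of "a + c" "b + d"] by (simp add: algebra_simps)
qed

lemma Zsqrt3_mult [simp]:
  assumes "x \<in> Zsqrt3" "y \<in> Zsqrt3"
  shows "x * y \<in> Zsqrt3"
proof -
  obtain a b c d where "x = of_int a + of_int b * sqrt 3" "y = of_int c + of_int d * sqrt 3"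
    using assms by (auto simp: Zsqrt3_def)
  then show ?thesis
    using Zsqrt3I[of "a * c + 3 * (b * d)" "a * d + b * c"] by (simp add: algebra_simps)
qed

lemma Zsqrt3_uminus [simp]: "x \<in> Zsqrt3 \<Longrightarrow> - x \<in> Zsqrt3"
  using Zsqrt3_mult[OF Zsqrt3_of_int[of "- 1"], of x] by simp

lemma Zsqrt3_diff [simp]: "x \<in> Zsqrt3 \<Longrightarrow> y \<in> Zsqrt3 \<Longrightarrow> x - y \<in> Zsqrt3"
  using Zsqrt3_add[of x "- y"] by simp

lemma Zsqrt3_power [simp]: "x \<in> Zsqrt3 \<Longrightarrow> x ^ n \<in> Zsqrt3"
  by (induction n) simp_all

lemma Zsqrt3_sum: "(\<And>i. i \<in> I \<Longrightarrow> f i \<in> Zsqrt3) \<Longrightarrow> sum f I \<in> Zsqrt3"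
  by (induction I rule: infinite_finite_induct) simp_all

text \<open>Otherwise the exponent of 3 would be even on the left and odd on the right.\<close>

lemma square_eq_3_square:
  fixes a b :: int
  assumes "a ^ 2 = 3 * b ^ 2"
  shows "b = 0"
proof (rule ccontr)
  assume b: "b \<noteq> 0"
  with assms have a: "a \<noteq> 0" by auto
  have pr: "prime_elem (3::int)"
    by simp
  have "multiplicity 3 (a ^ 2) = multiplicity 3 (3 * b ^ 2)"
    using assms by simp
  then have "2 * multiplicity 3 a = 1 + 2 * multiplicity 3 b"
    using a b pr by (simp add: prime_elem_multiplicity_power_distrib
        prime_elem_multiplicity_mult_distrib)
  then show False by presburger
qed

lemma of_int_eq_Zsqrt3_iff:
  "of_int c = of_int a + of_int b * sqrt 3 \<longleftrightarrow> c = a \<and> b = 0"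
proof
  assume *: "of_int c = of_int a + of_int b * sqrt 3"
  then have "(of_int (c - a)) ^ 2 = (of_int b * sqrt 3) ^ 2"
    by simp
  then have "real_of_int ((c - a) ^ 2) = of_int (3 * b ^ 2)"
    by (simp add: power_mult_distrib)
  then have "b = 0"
    using square_eq_3_square of_int_eq_iff by blast
  with * show "c = a \<and> b = 0" by simp
qed simp

definition cong3 :: "int \<Rightarrow> real \<Rightarrow> real \<Rightarrow> bool" where
  "cong3 m x y \<longleftrightarrow> (\<exists>z\<in>Zsqrt3. x - y = of_int m * z)"

lemma cong3_refl [simp]: "cong3 m x x"
  unfolding cong3_def by (rule bexI[of _ 0]) simp_all

lemma cong3_sym: "cong3 m x y \<Longrightarrow> cong3 m y x"
  unfolding cong3_def by (metis Zsqrt3_uminus minus_diff_eq mult_minus_right)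

lemma cong3_trans [trans]:
  assumes "cong3 m x y" "cong3 m y z"
  shows "cong3 m x z"
proof -
  obtain u v where "u \<in> Zsqrt3" "x - y = of_int m * u" "v \<in> Zsqrt3" "y - z = of_int m * v"
    using assms by (auto simp: cong3_def)
  then show ?thesis
    unfolding cong3_def by (intro bexI[of _ "u + v"]) (simp_all add: algebra_simps)
qed

lemma cong3_mult_left:
  assumes "cong3 m x y" "z \<in> Zsqrt3"
  shows "cong3 m (z * x) (z * y)"
proof -
  obtain u where "u \<in> Zsqrt3" "x - y = of_int m * u"
    using assms by (auto simp: cong3_def)
  then show ?thesis
    unfolding cong3_def using assms(2)
    by (intro bexI[of _ "z * u"]) (simp_all flip: right_diff_distrib)
qed

lemma cong3_mult:
  assumes "cong3 m x y" "cong3 m x' y'" "x' \<in> Zsqrt3" "y \<in> Zsqrt3"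
  shows "cong3 m (x * x') (y * y')"
  using cong3_mult_left[OF assms(1,3)] cong3_mult_left[OF assms(2,4)]
  by (metis cong3_trans mult.commute)

lemma cong3_power:
  assumes "cong3 m x y" "x \<in> Zsqrt3" "y \<in> Zsqrt3"
  shows "cong3 m (x ^ n) (y ^ n)"
  using assms by (induction n) (auto intro: cong3_mult)

lemma cong3_dvd:
  assumes "cong3 m x y" "q dvd m"
  shows "cong3 q x y"
proof -
  obtain u where "u \<in> Zsqrt3" "x - y = of_int m * u"
    using assms(1) by (auto simp: cong3_def)
  moreover obtain k where "m = q * k"
    using assms(2) by (elim dvdE)
  ultimately show ?thesis
    unfolding cong3_def by (intro bexI[of _ "of_int k * u"]) simp_all
qed

text \<open>Congruences found in the larger ring descend to the integers, because the
  \<open>sqrt 3\<close> coordinate of the quotient contributes nothing.\<close>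

lemma cong3_of_int_iff: "cong3 m (of_int c) (of_int d) \<longleftrightarrow> [c = d] (mod m)"
proof
  assume "cong3 m (of_int c) (of_int d)"
  then obtain a b where "real_of_int c - of_int d = of_int m * (of_int a + of_int b * sqrt 3)"
    by (auto simp: cong3_def Zsqrt3_def)
  then have "real_of_int (c - d) = of_int (m * a) + of_int (m * b) * sqrt 3"
    by (simp add: algebra_simps)
  then have "c - d = m * a"
    unfolding of_int_eq_Zsqrt3_iff by simp
  then show "[c = d] (mod m)"
    by (simp add: cong_iff_dvd_diff)
next
  assume "[c = d] (mod m)"
  then obtain k where "c - d = m * k"
    by (auto simp: cong_iff_dvd_diff)
  then have "real_of_int c - of_int d = of_int m * of_int k"
    by (metis of_int_diff of_int_mult)
  then show "cong3 m (of_int c) (of_int d)"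
    unfolding cong3_def using Zsqrt3_of_int by blast
qed

text \<open>The Frobenius map: \<open>p\<close> divides the inner binomial coefficients, and
  \<open>z\<close> collects the quotients.\<close>

lemma cong3_add_one_power_prime:
  assumes "prime p" "x \<in> Zsqrt3"
  shows "cong3 (int p) ((1 + x) ^ p) (1 + x ^ p)"
proof -
  obtain m where p: "p = Suc m"
    using assms(1) by (metis not0_implies_Suc not_prime_0)
  define z where "z = (\<Sum>k\<in>{1..m}. of_nat ((p choose k) div p) * x ^ k)"
  have "z \<in> Zsqrt3"
    unfolding z_def using assms(2) by (intro Zsqrt3_sum) simp
  have "(1 + x) ^ p = (\<Sum>k\<le>p. of_nat (p choose k) * x ^ k)"
    using binomial_ring[of x 1 p] by (simp add: add.commute)
  also have "{..p} = insert 0 (insert p {1..m})"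
    by (auto simp: p)
  also have "(\<Sum>k\<in>insert 0 (insert p {1..m}). of_nat (p choose k) * x ^ k) =
      1 + x ^ p + (\<Sum>k\<in>{1..m}. of_nat (p choose k) * x ^ k)"
    by (simp add: p)
  also have "(\<Sum>k\<in>{1..m}. of_nat (p choose k) * x ^ k) = of_int (int p) * z"
    unfolding z_def sum_distrib_left
  proof (rule sum.cong)
    fix k assume k: "k \<in> {1..m}"
    have "p dvd (p choose k)"
      by (rule dvd_choose_prime) (use k assms in \<open>auto simp: p\<close>)
    then have "real (p choose k) = real p * real ((p choose k) div p)"
      by (metis dvd_mult_div_cancel of_nat_mult)
    then show "real (p choose k) * x ^ k = of_int (int p) * (real ((p choose k) div p) * x ^ k)"
      by simp
  qed simp
  finally show ?thesis
    unfolding cong3_def using \<open>z \<in> Zsqrt3\<close> by (intro bexI[of _ z]) simp_all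
qed

section \<open>The Lucas--Lehmer test\<close>

text \<open>The norm of \<open>2 + sqrt 3\<close> is 4 - 3 = 1, so conjugate powers are inverse
  units.\<close>

lemma power_mult_conj_power: "(2 + sqrt 3) ^ k * (2 - sqrt 3) ^ k = (1::real)"
  by (simp flip: power_mult_distrib add: algebra_simps)

lemma power_add_conj_power:
  obtains S :: int where "(2 + sqrt 3) ^ k + (2 - sqrt 3) ^ k = of_int S"
proof -
  have "\<exists>u v :: int. (2 + sqrt 3) ^ k = of_int u + of_int v * sqrt 3 \<and>
    (2 - sqrt 3) ^ k = of_int u - of_int v * sqrt 3"
  proof (induction k)
    case 0
    then show ?case by (intro exI[of _ 1] exI[of _ 0]) simp
  next
    case (Suc k)
    then obtain u v :: int where uv: "(2 + sqrt 3) ^ k = of_int u + of_int v * sqrt 3"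
      "(2 - sqrt 3) ^ k = of_int u - of_int v * sqrt 3" by blast
    show ?case
      unfolding power_Suc uv
      by (intro exI[of _ "2 * u + 3 * v"] exI[of _ "u + 2 * v"]) (simp add: algebra_simps)
  qed
  then obtain u v :: int where "(2 + sqrt 3) ^ k + (2 - sqrt 3) ^ k = of_int (2 * u)"
    by auto
  then show ?thesis
    by (rule that)
qed

text \<open>The powers of \<open>2 + sqrt 3\<close> with exponent below \<open>2 ^ p\<close> are pairwise incongruent, whereas there
  are only \<open>q\<^sup>2\<close> residue classes modulo \<open>q\<close>.\<close>

lemma power_two_le_square_of_cong3:
  assumes "2 < q" "cong3 q ((2 + sqrt 3) ^ 2 ^ (p - 1)) (- 1)"
  shows "2 ^ p \<le> q ^ 2"
proof -
  define w where "w = 2 + sqrt 3"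
  have w: "w \<in> Zsqrt3" "2 - sqrt 3 \<in> Zsqrt3"
    by (simp_all add: w_def)
  have no_one: "\<not> cong3 q (w ^ d) 1" if d: "0 < d" "d < 2 ^ p" for d
  proof
    assume one: "cong3 q (w ^ d) 1"
    \<comment> \<open>As \<open>m\<close> is odd, raising \<open>w ^ d\<close> to the power
      \<open>2 ^ (p - 1 - e)\<close> gives an odd power of \<open>w ^ 2 ^ (p - 1)\<close>. Hence 1
      and -1 would be congruent modulo \<open>q\<close>, which exceeds 2.\<close>
    obtain e m where em: "d = 2 ^ e * m" "odd m"
    proof (rule multiplicity_decompose'[of d 2])
      fix y
      assume "d = 2 ^ multiplicity 2 d * y" "\<not> 2 dvd y"
      then show thesis
        by (rule that)
    qed (use d in auto)
    have "2 ^ e \<le> d"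
      using em by (cases m) auto
    then have "(2::nat) ^ e < 2 ^ p"
      using d(2) by (rule le_less_trans)
    then have "e < p"
      by (rule power_less_imp_less_exp[rotated]) simp
    then have e: "e \<le> p - 1"
      by simp
    have "(w ^ d) ^ 2 ^ (p - 1 - e) = (w ^ 2 ^ (p - 1)) ^ m"
    proof -
      have "(2::nat) ^ e * 2 ^ (p - 1 - e) = 2 ^ (p - 1)"
        using e by (simp flip: power_add)
      then have "d * 2 ^ (p - 1 - e) = 2 ^ (p - 1) * m"
        by (simp add: em(1) mult_ac)
      then show ?thesis
        by (simp flip: power_mult)
    qed
    moreover have "cong3 q ((w ^ d) ^ 2 ^ (p - 1 - e)) (1 ^ 2 ^ (p - 1 - e))"
      by (intro cong3_power one) (use w in auto)
    moreover have "cong3 q ((w ^ 2 ^ (p - 1)) ^ m) ((- 1) ^ m)"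
      by (intro cong3_power) (use w assms in \<open>auto simp: w_def\<close>)
    ultimately have "cong3 q (of_int 1) (of_int (- 1))"
      using em(2) by (metis cong3_sym cong3_trans of_int_1 of_int_minus power_minus_odd power_one)
    then have "q dvd 2"
      unfolding cong3_of_int_iff by (simp add: cong_iff_dvd_diff)
    with assms(1) show False
      using zdvd_imp_le by fastforce
  qed
  have "\<forall>i. \<exists>a b :: int. w ^ i = of_int a + of_int b * sqrt 3"
    using Zsqrt3_power[OF w(1)] unfolding Zsqrt3_def by blast
  then obtain a b :: "nat \<Rightarrow> int" where ab: "\<And>i. w ^ i = of_int (a i) + of_int (b i) * sqrt 3"
    by metis
  define f where "f i = (a i mod q, b i mod q)" for i
  have neq: "f i \<noteq> f j" if ij: "i < j" "j < 2 ^ p" for i j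
  proof
    assume "f i = f j"
    then have "q dvd a j - a i" "q dvd b j - b i"
      by (auto simp: f_def mod_eq_dvd_iff dvd_diff_commute)
    then obtain c d where cd: "a j - a i = q * c" "b j - b i = q * d"
      by (auto elim!: dvdE)
    have "w ^ j - w ^ i = of_int (a j - a i) + of_int (b j - b i) * sqrt 3"
      by (simp add: ab algebra_simps)
    also have "\<dots> = of_int q * (of_int c + of_int d * sqrt 3)"
      unfolding cd by (simp add: algebra_simps)
    finally have "cong3 q (w ^ j) (w ^ i)"
      unfolding cong3_def using Zsqrt3I by blast
    \<comment> \<open>The conjugate is the inverse of \<open>w\<close>, so this cancels
      \<open>w ^ i\<close>.\<close>
    then have "cong3 q ((2 - sqrt 3) ^ i * w ^ j) ((2 - sqrt 3) ^ i * w ^ i)"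
      by (intro cong3_mult_left) (use w in auto)
    moreover have "w ^ j = w ^ i * w ^ (j - i)"
      using ij by (simp flip: power_add)
    ultimately have "cong3 q (w ^ (j - i)) 1"
      using power_mult_conj_power[of i] by (simp add: w_def mult.commute flip: mult.assoc)
    then show False
      using no_one[of "j - i"] ij by auto
  qed
  then have "inj_on f {..<2 ^ p}"
    by (intro linorder_inj_onI) auto
  moreover have "f ` {..<2 ^ p} \<subseteq> {0..<q} \<times> {0..<q}"
    using assms(1) by (auto simp: f_def)
  ultimately have "card {..<2 ^ p :: nat} \<le> card ({0..<q} \<times> {0..<q})"
    by (intro card_inj_on_le) auto
  then have "2 ^ p \<le> nat q * nat q"
    by simp
  then have "int (2 ^ p) \<le> int (nat q * nat q)"
    by (subst of_nat_le_iff)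
  then show ?thesis
    using assms(1) by (simp add: power2_eq_square)
qed

section \<open>Powers of 2 and 3 modulo a Mersenne prime\<close>

lemma mersenne_cong_one: "[2 ^ p = 1] (mod (2 ^ p - 1 :: int))"
  by (simp add: cong_iff_dvd_diff)

lemma two_power_mersenne:
  assumes "prime (2 ^ p - 1 :: nat)" "odd p" "2 \<le> p"
  shows "[2 ^ 2 ^ (p - 1) = 2] (mod (2 ^ p - 1 :: int))"
proof -
  define M :: nat where "M = 2 ^ p - 1"
  have Mint: "int M = 2 ^ p - 1"
    by (simp add: M_def of_nat_diff)
  define r where "r = (p + 1) div 2"
  have r: "2 * r = Suc p"
    using assms(2) by (simp add: r_def)
  have half: "2 * 2 ^ (p - 1) = Suc M"
    using assms(3) by (cases p) (simp_all add: M_def)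
  have "odd M"
    using half assms(3) by (simp add: M_def)
  have "\<not> M dvd 2 ^ r"
    using \<open>odd M\<close> assms(1) prime_dvd_power[of M 2 r] M_def
    by (metis dvd_refl primes_dvd_imp_eq two_is_prime_nat)
  then have "[(2 ^ r) ^ (M - 1) = 1] (mod M)"
    using fermat_theorem assms(1) M_def by blast
  then have fermat: "[(2 ^ r) ^ (M - 1) = 1] (mod int M)"
    using cong_int_iff[of "(2 ^ r) ^ (M - 1)" 1 M] by simp
  \<comment> \<open>2 is a square modulo \<open>M\<close> because \<open>2 ^ p\<close> is 1 and \<open>p\<close> is odd.\<close>
  have sq: "[(2 ^ r) ^ 2 = 2] (mod int M)"
  proof -
    have "(2 ^ r) ^ 2 = 2 * (2 ^ p :: int)"
      by (simp flip: power_mult add: mult.commute[of r] r)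
    then show ?thesis
      using cong_mult[OF cong_refl[of 2] mersenne_cong_one[of p]] by (simp add: Mint)
  qed
  have "[2 ^ 2 ^ (p - 1) = ((2 ^ r) ^ 2) ^ 2 ^ (p - 1)] (mod int M)"
    by (rule cong_pow[OF cong_sym[OF sq]])
  \<comment> \<open>The total exponent of \<open>2 ^ r\<close> is
    \<open>2 ^ p = (M - 1) + 2\<close>, so Fermat's theorem leaves a single square.\<close>
  also have "((2 ^ r) ^ 2) ^ 2 ^ (p - 1) = (((2 ^ r) ^ (M - 1)) * (2 ^ r) ^ 2 :: int)"
  proof -
    have "2 * 2 ^ (p - 1) = M - 1 + 2"
      using half odd_pos[OF \<open>odd M\<close>] by simp
    then show ?thesis
      by (simp only: power_mult[symmetric, of _ 2] power_add)
  qed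
  also have "[\<dots> = 1 * 2] (mod int M)"
    by (rule cong_mult[OF fermat sq])
  finally show ?thesis
    by (simp add: Mint)
qed

text \<open>Here \<open>M\<close> is 1 modulo 3 and 3 modulo 4. Quadratic reciprocity therefore
  makes 3 a nonresidue, and Euler's criterion gives the power.\<close>

lemma three_power_mersenne:
  assumes "prime (2 ^ p - 1 :: nat)" "odd p" "3 \<le> p"
  shows "[3 ^ ((2 ^ p - 1 - 1) div 2) = - 1] (mod (2 ^ p - 1 :: int))"
proof -
  define M :: nat where "M = 2 ^ p - 1"
  have Mint: "int M = 2 ^ p - 1"
    by (simp add: M_def of_nat_diff)
  obtain k where k: "p = 2 * k + 3"
  proof -
    obtain i where "p = 2 * i + 1"
      using assms(2) by (elim oddE)
    then show ?thesis
      using assms(3) by (intro that[of "i - 1"]) simp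
  qed
  have p8: "(2::nat) ^ p = 8 * 4 ^ k"
    by (simp add: k power_add power_mult)
  have "[(4::nat) ^ k = 1 ^ k] (mod 3)"
    by (intro cong_pow) (simp add: cong_def)
  then have "(4::nat) ^ k mod 3 = 1"
    by (simp add: cong_def)
  then obtain x where "(4::nat) ^ k = 3 * x + 1"
    by (metis mult_div_mod_eq)
  then have "M = 1 + 3 * (8 * x + 2)"
    unfolding M_def p8 by simp
  then have M3: "M mod 3 = 1"
    by (simp only: mod_mult_self2) simp
  obtain y where "(4::nat) ^ k = Suc y"
    using not0_implies_Suc[of "4 ^ k"] by auto
  then have "M = 3 + 4 * (2 * y + 1)"
    unfolding M_def p8 by simp
  then have M4: "M mod 4 = 3"
    by (simp only: mod_mult_self2) simp
  \<comment> \<open>The bound keeps \<open>M\<close> different from 3, since reciprocity concerns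
    two distinct odd primes.\<close>
  have "8 * 1 \<le> 8 * (4::nat) ^ k"
    by (intro mult_le_mono2) simp
  then have M: "7 \<le> M"
    unfolding M_def p8 by linarith
  have "[int M = 1] (mod 3)"
    using M3 cong_int_iff[of M 1 3] by (simp add: cong_def)
  then have L1: "Legendre (int M) 3 = 1"
    unfolding Legendre_def QuadRes_def
    by (auto simp: cong_def intro!: exI[of _ 1])
  have "Legendre (int 3) (int M) * Legendre (int M) (int 3) =
      (- 1) ^ ((3 - 1) div 2 * ((M - 1) div 2))"
    using Quadratic_Reciprocity[of 3 M] assms(1) M M_def by simp
  moreover have "odd ((M - 1) div 2)"
    using M4 by presburger
  ultimately have L: "Legendre 3 (int M) = - 1"
    using L1 by simp
  have "[Legendre 3 (int M) = 3 ^ ((M - 1) div 2)] (mod int M)"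
    using euler_criterion[of M 3] assms(1) M M_def by simp
  then show ?thesis
    unfolding L by (simp add: Mint cong_sym M_def)
qed

text \<open>Compute \<open>(1 + sqrt 3) ^ (M + 1)\<close> for \<open>M = 2 ^ p - 1\<close> in two ways: by the Frobenius map, where 3 is a
  quadratic nonresidue, and as a power of \<open>(1 + sqrt 3)\<^sup>2 = 2 * (2 + sqrt 3)\<close>.\<close>

lemma mersenne_prime_imp_cong3:
  assumes "prime (2 ^ p - 1 :: nat)" "odd p" "3 \<le> p"
  shows "cong3 (2 ^ p - 1) ((2 + sqrt 3) ^ 2 ^ (p - 1)) (- 1)"
proof -
  define M :: nat where "M = 2 ^ p - 1"
  have Mint: "int M = 2 ^ p - 1"
    by (simp add: M_def of_nat_diff)
  define H :: nat where "H = 2 ^ (p - 1)"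
  define w where "w = 2 + sqrt 3"
  define m where "m = (M - 1) div 2"
  have M: "Suc M = 2 * H"
    using assms(3) by (cases p) (simp_all add: M_def H_def)
  have "2 \<le> H"
    unfolding H_def using assms(3) self_le_power[of "2::nat" "p - 1"] by simp
  with M have Mm: "M = Suc (2 * m)"
    unfolding m_def by presburger
  have two: "cong3 M (2 ^ H) 2"
    using two_power_mersenne[OF assms(1,2)] assms(3) cong3_of_int_iff[of M "2 ^ H" 2]
    by (simp add: Mint H_def)
  have three: "cong3 M (3 ^ m) (- 1)"
    using three_power_mersenne[OF assms] cong3_of_int_iff[of M "3 ^ m" "- 1"]
    by (simp add: Mint m_def M_def)
  have "cong3 M ((1 + sqrt 3) ^ M) (1 + sqrt 3 ^ M)"
    using cong3_add_one_power_prime[of M "sqrt 3"] assms(1) by (simp add: M_def)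
  also have "sqrt 3 ^ M = sqrt 3 * 3 ^ m"
    by (simp add: Mm power_mult)
  also have "cong3 M (1 + sqrt 3 * 3 ^ m) (1 - sqrt 3)"
    using cong3_mult_left[OF three, of "sqrt 3"] by (simp add: cong3_def)
  finally have "cong3 M ((1 + sqrt 3) * (1 + sqrt 3) ^ M) ((1 + sqrt 3) * (1 - sqrt 3))"
    by (rule cong3_mult_left) simp
  also have "(1 + sqrt 3) * (1 + sqrt 3) ^ M = ((1 + sqrt 3) ^ 2) ^ H"
    by (simp add: M flip: power_Suc power_mult)
  also have "(1 + sqrt 3) ^ 2 = 2 * w"
    by (simp add: w_def power2_eq_square algebra_simps)
  also have "(1 + sqrt 3) * (1 - sqrt 3) = - 2"
    by (simp add: algebra_simps)
  finally have *: "cong3 M (2 ^ H * w ^ H) (- 2)"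
    by (simp add: power_mult_distrib)
  have "cong3 M (2 * w ^ H) (2 ^ H * w ^ H)"
    by (rule cong3_mult[OF cong3_sym[OF two]]) (simp_all add: w_def)
  then have "cong3 M (2 * w ^ H) (- 2)"
    using * cong3_trans by blast
  \<comment> \<open>\<open>H\<close> inverts 2 modulo \<open>M\<close>, because
    \<open>2 * H = M + 1\<close>.\<close>
  then have "cong3 M (of_nat H * (2 * w ^ H)) (of_nat H * - 2)"
    by (rule cong3_mult_left) simp
  moreover have "2 * real H = 1 + of_int (int M)"
    using M by (metis of_int_of_nat_eq of_nat_Suc of_nat_mult of_nat_numeral)
  ultimately have **: "cong3 M ((1 + of_int (int M)) * w ^ H) (- (1 + of_int (int M)))"
    by (metis (no_types, lifting) mult.assoc mult.commute mult_minus_right)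
  then obtain z where z: "z \<in> Zsqrt3"
    "(1 + of_int (int M)) * w ^ H - (- (1 + of_int (int M))) = of_int (int M) * z"
    by (auto simp: cong3_def)
  \<comment> \<open>The two multiples of \<open>M\<close> on the left of the previous equation move
    into the quotient.\<close>
  have "w ^ H - (- 1) = of_int (int M) * (z - w ^ H - 1)"
    using z(2) by (simp add: algebra_simps)
  then have "cong3 M (w ^ H) (- 1)"
    unfolding cong3_def using z(1) by (intro bexI[of _ "z - w ^ H - 1"]) (simp_all add: w_def)
  then show ?thesis
    by (simp add: Mint H_def w_def)
qed

text \<open>A composite \<open>M\<close> has a divisor \<open>a > 2\<close> with
  \<open>a ^ 2\<close> at most \<open>M\<close>. The congruence survives modulo \<open>a\<close>,
  and counting residue classes gives \<open>2 ^ p\<close> at most \<open>a ^ 2\<close>, a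
  contradiction.\<close>

lemma cong3_imp_mersenne_prime:
  assumes "cong3 (2 ^ p - 1) ((2 + sqrt 3) ^ 2 ^ (p - 1)) (- 1)" "2 \<le> p"
  shows "prime (2 ^ p - 1 :: nat)"
proof (rule ccontr)
  define M :: nat where "M = 2 ^ p - 1"
  have Mint: "int M = 2 ^ p - 1"
    by (simp add: M_def of_nat_diff)
  have "2 ^ 2 \<le> (2::nat) ^ p"
    using assms(2) by (intro power_increasing) auto
  then have "1 < M"
    unfolding M_def by simp
  have "odd M"
    using assms(2) by (simp add: M_def)
  assume "\<not> prime (2 ^ p - 1 :: nat)"
  then obtain c where c: "c dvd M" "c \<noteq> 1" "c \<noteq> M"
    using \<open>1 < M\<close> unfolding M_def[symmetric] prime_nat_iff by blast
  then obtain d where d: "M = c * d"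
    by (elim dvdE)
  have "1 < c" "1 < d"
    using c d \<open>1 < M\<close> by (auto simp: nat_neq_iff)
  then obtain a b where ab: "M = a * b" "1 < a" "a \<le> b"
    using d by (metis linorder_le_cases mult.commute)
  have "odd a"
    using ab(1) \<open>odd M\<close> by simp
  then have "2 < int a"
    using ab(2) by (cases "a = 2") auto
  moreover have "cong3 (int a) ((2 + sqrt 3) ^ 2 ^ (p - 1)) (- 1)"
    by (rule cong3_dvd[OF assms(1)]) (simp add: ab(1) flip: Mint)
  ultimately have "2 ^ p \<le> int a ^ 2"
    by (rule power_two_le_square_of_cong3)
  also have "\<dots> \<le> int M"
    using ab by (simp add: power2_eq_square)
  finally show False
    by (simp add: Mint)
qed

text \<open>\<open>S\<close> is the term s_(p-2) of the sequence s_0 = 4, s_(i+1) = s_i^2 - 2.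
  Multiplying it by the unit \<open>w ^ h\<close> gives \<open>w ^ (2 * h) + 1\<close>, so
  divisibility says that \<open>w ^ 2 ^ (p - 1)\<close> is congruent to -1.\<close>

theorem lucas_lehmer:
  assumes "odd p" "3 \<le> p" "(2 + sqrt 3) ^ 2 ^ (p - 2) + (2 - sqrt 3) ^ 2 ^ (p - 2) = of_int S"
  shows "prime (2 ^ p - 1 :: nat) \<longleftrightarrow> 2 ^ p - 1 dvd S"
proof -
  define h :: nat where "h = 2 ^ (p - 2)"
  define w where "w = 2 + sqrt 3"
  define w' where "w' = 2 - sqrt 3"
  have w: "w \<in> Zsqrt3" "w' \<in> Zsqrt3"
    by (simp_all add: w_def w'_def)
  have ww: "w ^ h * w' ^ h = 1"
    using power_mult_conj_power by (simp add: w_def w'_def)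
  have H: "2 ^ (p - 1) = h + h"
  proof -
    have "p - 1 = Suc (p - 2)"
      using assms(2) by simp
    then show ?thesis
      by (simp add: h_def)
  qed
  have S: "of_int S = w ^ h + w' ^ h"
    using assms(3) by (simp add: w_def w'_def h_def)
  have eq1: "w ^ h * of_int S = w ^ 2 ^ (p - 1) - (- 1)"
    unfolding H S power_add distrib_left ww by simp
  have eq2: "w' ^ h * (w ^ 2 ^ (p - 1) - (- 1)) = of_int S"
    unfolding eq1[symmetric] by (metis ww mult.assoc mult.commute mult_1)
  have "2 ^ p - 1 dvd S \<longleftrightarrow> cong3 (2 ^ p - 1) (of_int S) 0"
    using cong3_of_int_iff[of "2 ^ p - 1" S 0] by (simp add: cong_0_iff)
  also have "\<dots> \<longleftrightarrow> cong3 (2 ^ p - 1) (w ^ 2 ^ (p - 1) - (- 1)) 0"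
    using cong3_mult_left[of "2 ^ p - 1" _ 0 "w ^ h"] cong3_mult_left[of "2 ^ p - 1" _ 0 "w' ^ h"]
      eq1 eq2 w by (metis Zsqrt3_power mult_zero_right)
  also have "\<dots> \<longleftrightarrow> cong3 (2 ^ p - 1) (w ^ 2 ^ (p - 1)) (- 1)"
    by (simp add: cong3_def)
  also have "\<dots> \<longleftrightarrow> prime (2 ^ p - 1 :: nat)"
    using mersenne_prime_imp_cong3[of p] cong3_imp_mersenne_prime[of p] assms(1,2)
    by (auto simp: w_def)
  finally show ?thesis ..
qed

section \<open>The divisibility criterion\<close>

theorem theorem52:
  fixes p n :: nat
  assumes "prime p" and "p \<ge> 5" and "n = 2 ^ (p - 1)"
  shows "prime (2 ^ p - 1 :: nat) \<longleftrightarrow>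
    quanta_Omega 0 (n div 2) (0::int) (-1) n * quanta_Omega 0 (p div 2) (-2::int) (-5) p
      dvd quanta_Omega 0 (n div 2) (1::int) 4 n * quanta_Omega 0 (p div 2) (0::int) (-1) p"
proof -
  have "odd p"
    using assms(1,2) prime_odd_nat[of p] by simp
  define h where "h = n div 2"
  have h: "h = 2 ^ (p - 2)" "n = 2 * h"
  proof -
    have "p - 1 = Suc (p - 2)"
      using assms(2) by simp
    then show "h = 2 ^ (p - 2)" "n = 2 * h"
      by (simp_all add: h_def assms(3))
  qed
  have "even h"
    using assms(2) by (simp add: h(1))
  have "2 \<le> n"
    using self_le_power[of "2::nat" "p - 1"] assms(2,3) by simp
  define P where "P N = (\<Prod>i<N div 2. real N - real (N div 2) + real i)" for N
  have P: "P N \<noteq> 0" if "2 \<le> N" for N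
  proof -
    have "real (N div 2) < real N"
      using that by simp
    then have "0 < P N"
      unfolding P_def by (intro prod_pos) auto
    then show ?thesis by simp
  qed
  have base: "real_of_int (quanta_Omega 0 (N div 2) 0 (- 1) N) = P N" if "2 \<le> N" for N
    using quanta_Omega_half[of 1 0 0 "- 1 :: real" N] that
    by (simp add: of_int_quanta_Omega P_def)
  have B: "quanta_Omega 0 (p div 2) (- 2) (- 5) p =
      quanta_Omega 0 (p div 2) (0::int) (- 1) p * (2 ^ p - 1)"
  proof -
    have "real_of_int (quanta_Omega 0 (p div 2) (- 2) (- 5) p) = P p * (2 ^ p - 1)"
      using quanta_Omega_half[of 2 "- 1" "- 2" "- 5 :: real" p] assms(2) \<open>odd p\<close>
      by (simp add: of_int_quanta_Omega P_def)
    also have "\<dots> = of_int (quanta_Omega 0 (p div 2) 0 (- 1) p * (2 ^ p - 1))"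
      using base[of p] assms(2) by simp
    finally show ?thesis
      by (simp only: of_int_eq_iff)
  qed
  obtain S where S: "(2 + sqrt 3) ^ h + (2 - sqrt 3) ^ h = of_int S"
    by (rule power_add_conj_power)
  have C: "quanta_Omega 0 (n div 2) 1 4 n = quanta_Omega 0 (n div 2) (0::int) (- 1) n * S"
  proof -
    have sq: "((1 + sqrt 3) / 2) ^ 2 = (2 + sqrt 3) / 2" "((1 - sqrt 3) / 2) ^ 2 = (2 - sqrt 3) / 2"
      by (simp_all add: power2_eq_square field_simps)
    have "real_of_int (quanta_Omega 0 (n div 2) 1 4 n) =
        P n * (- 2) ^ h * (((1 + sqrt 3) / 2) ^ n + ((1 - sqrt 3) / 2) ^ n)"
      using quanta_Omega_half[of "(1 + sqrt 3) / 2" "(1 - sqrt 3) / 2" 1 4 n] \<open>2 \<le> n\<close>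
      by (simp add: of_int_quanta_Omega P_def h_def field_simps)
    \<comment> \<open>Since \<open>n = 2 * h\<close>, squaring the two bases halves the exponent;
      the sign of \<open>(- 2) ^ h\<close> disappears because \<open>h\<close> is even.\<close>
    also have "\<dots> = P n * (2 ^ h * (((2 + sqrt 3) / 2) ^ h + ((2 - sqrt 3) / 2) ^ h))"
      unfolding h(2) power_mult sq using \<open>even h\<close> by simp
    also have "2 ^ h * (((2 + sqrt 3) / 2) ^ h + ((2 - sqrt 3) / 2) ^ h) = of_int S"
      by (simp add: power_divide S flip: add_divide_distrib)
    also have "P n * of_int S = of_int (quanta_Omega 0 (n div 2) 0 (- 1) n * S)"
      using base[of n] \<open>2 \<le> n\<close> by simp
    finally show ?thesis
      by (simp only: of_int_eq_iff)
  qed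
  \<comment> \<open>By \<open>B\<close> and \<open>C\<close> this is a common factor of both sides
    of the divisibility; it is nonzero because \<open>P n\<close> and \<open>P p\<close>
    are.\<close>
  define K where "K = quanta_Omega 0 (n div 2) (0::int) (- 1) n * quanta_Omega 0 (p div 2) 0 (- 1) p"
  have "real_of_int K \<noteq> 0"
    unfolding K_def using base[of n] base[of p] P[of n] P[of p] \<open>2 \<le> n\<close> assms(2) by simp
  then have "K \<noteq> 0"
    by simp
  have "quanta_Omega 0 (n div 2) (0::int) (-1) n * quanta_Omega 0 (p div 2) (-2::int) (-5) p
      dvd quanta_Omega 0 (n div 2) (1::int) 4 n * quanta_Omega 0 (p div 2) (0::int) (-1) p \<longleftrightarrow>
      K * (2 ^ p - 1) dvd K * S"
    unfolding B C K_def by (simp add: mult_ac)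
  also have "\<dots> \<longleftrightarrow> 2 ^ p - 1 dvd S"
    using \<open>K \<noteq> 0\<close> by simp
  also have "\<dots> \<longleftrightarrow> prime (2 ^ p - 1 :: nat)"
    using lucas_lehmer[of p S] \<open>odd p\<close> assms(2) S by (simp add: h(1))
  finally show ?thesis ..
qed

end
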